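(* Let $0\le \underline{k}\le\overline{k}$ and $m\ge 1$ be integers. As formal power series in $x$, $$\sum_{n\ge 0} w^{\ge m}_{\underline{k}\le\overline{k}}(n)\,x^n=\frac{1-x}{(1-2x)\,x}\left(\frac{x^{\underline{k}+1}-x^{\overline{k}+2}}{1-2x+x^{\underline{k}+1}-x^{\overline{k}+2}}\right)^m.$$
   Context: An $n$-string is a binary string of length $n$. A run of ones is a maximal block of consecutive ones, flanked on each side by a zero or by the start/end of the string. Null runs (length $0$) of ones also count: there is one between every two consecutive zeros, one before an initial zero and one after a final zero; thus a string with $z$ zeros has exactly $z+1$ runs of ones (including null ones), namely the possibly empty blocks of ones delimited by the zeros; the empty string has one null run. $w^{\ge m}_{\underline{k}\le\overline{k}}(n)$ is the number of $n$-strings containing at least $m$ runs of ones whose length lies in $[\underline{k},\overline{k}]$ (null runs included if $\underline{k}=0$). *)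

theory Defs
  imports "HOL-Computational_Algebra.Formal_Laurent_Series"
begin

definition strings :: "nat \<Rightarrow> bool list set" where
  "strings n = {s. length s = n}"

(* In a binary string True is the digit one and False the digit zero.  A run of ones is the pair
   (i, j) of its end points: it occupies the positions i, ..., j - 1 and has length j - i.
   Null runs are the pairs with i = j. *)
definition runs_of_ones :: "bool list \<Rightarrow> (nat \<times> nat) set" where
  "runs_of_ones s = {(i, j). i \<le> j \<and> j \<le> length s \<and>
     (\<forall>l. i \<le> l \<and> l < j \<longrightarrow> s ! l) \<and>
     (i = 0 \<or> \<not> s ! (i - 1)) \<and>
     (j = length s \<or> \<not> s ! j)}"

definition num_runs_between :: "nat \<Rightarrow> nat \<Rightarrow> bool list \<Rightarrow> nat" where
  "num_runs_between klo khi s =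
     card {(i, j) \<in> runs_of_ones s. klo \<le> j - i \<and> j - i \<le> khi}"

definition w_at_least :: "nat \<Rightarrow> nat \<Rightarrow> nat \<Rightarrow> nat \<Rightarrow> nat" where
  "w_at_least m klo khi n = card {s \<in> strings n. num_runs_between klo khi s \<ge> m}"

end

theory Submission
  imports Defs
begin

text \<open>
  Cut a binary string after each of its zeros: it becomes a sequence of blocks \<open>1\<^sup>l0\<close>
  followed by a final run of ones, and appending one virtual zero turns the final run into a
  block as well. Thus \<open>x F(x)\<close>, where \<open>F\<close> is the generating function of the theorem, counts
  sequences of blocks containing at least \<open>m\<close> good ones, a block being good if its length of
  ones lies in the given interval. With \<open>g = x^(klo+1) - x^(khi+2)\<close>, the good blocks have
  generating function \<open>g / (1 - x)\<close> and all blocks \<open>x / (1 - x)\<close>. Such a sequence is uniquely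
  \<open>m\<close> times (bad blocks, then a good block), followed by anything, which gives
  \[ \left(\frac{g/(1-x)}{1 - (x - g)/(1-x)}\right)^m \cdot \frac{1}{1 - x/(1-x)}
     = \left(\frac{g}{1-2x+g}\right)^m \cdot \frac{1-x}{1-2x}. \]

  The formal argument peels off one block at a time, so that no bijection with sequences of
  blocks has to be set up. The lemma \<open>num_runs_between_first_run\<close> says what removing the first
  block does to the number of good runs; it yields the recursion \<open>w_at_least_Suc\<close> for the
  counts. For the generating function \<open>W m\<close> of the strings with at least \<open>m\<close> good runs, it reads
  \<open>(1 - 2x + g) (x W (m+1)) = g ([m = 0] + x W m)\<close> (lemma \<open>w_gf_step\<close>). The extra \<open>1\<close> at
  \<open>m = 0\<close> is the empty sequence of blocks, which corresponds to no string; it is also the reason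
  why the closed form holds only from \<open>m = 1\<close> on. Induction on \<open>m\<close> (lemma \<open>w_gf_closed\<close>),
  started from \<open>W 0 = 1 / (1 - 2x)\<close>, finishes the proof. All identities are kept free of
  denominators until the passage to Laurent series, where one may divide by \<open>x\<close>.
\<close>

section \<open>Splitting off the first run\<close>

lemma runs_of_ones_replicate: "runs_of_ones (replicate n True) = {(0, n)}"
proof (intro set_eqI iffI)
  fix p assume p: "p \<in> runs_of_ones (replicate n True)"
  obtain i j where ij: "p = (i, j)" by force
  have "i = 0" "j = n"
    using p unfolding ij runs_of_ones_def by (auto simp: nth_append)
  then show "p \<in> {(0, n)}" by (simp add: ij)
qed (auto simp: runs_of_ones_def)

text \<open>
  The zero at position \<open>l\<close> separates the runs: one that starts at or before it must start at
  \<open>0\<close> (every earlier neighbour is a one) and stop at \<open>l\<close>; any other lies strictly behind it.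
\<close>

lemma runs_of_ones_first_run:
  "runs_of_ones (replicate l True @ False # t) =
     insert (0, l) ((\<lambda>(i, j). (i + Suc l, j + Suc l)) ` runs_of_ones t)"
    (is "runs_of_ones ?s = insert _ (?f ` _)")
proof (intro set_eqI iffI)
  have ones: "?s ! p" if "p < l" for p using that by (simp add: nth_append)
  have zero: "\<not> ?s ! l" by (simp add: nth_append)
  have rest: "?s ! (p + Suc l) = t ! p" for p by (simp add: nth_append)
  fix p assume p: "p \<in> runs_of_ones ?s"
  obtain i j where ij: "p = (i, j)" by force
  have r: "i \<le> j" "j \<le> l + Suc (length t)" "\<And>q. i \<le> q \<Longrightarrow> q < j \<Longrightarrow> ?s ! q"
      "i = 0 \<or> \<not> ?s ! (i - 1)" "j = l + Suc (length t) \<or> \<not> ?s ! j"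
    using p unfolding ij runs_of_ones_def by auto
  show "p \<in> insert (0, l) (?f ` runs_of_ones t)"
  proof (cases "i \<le> l")
    case True
    have "i = 0" using r(4) ones[of "i - 1"] True by (cases i) auto
    moreover have "j \<le> l" using r(3)[of l] zero True by (meson not_le)
    moreover have "\<not> j < l" using r(5) ones[of j] by auto
    ultimately show ?thesis by (simp add: ij)
  next
    case False
    define i' j' where "i' = i - Suc l" and "j' = j - Suc l"
    have i: "i = i' + Suc l" and j: "j = j' + Suc l"
      using False r(1) by (auto simp: i'_def j'_def)
    have "(i', j') \<in> runs_of_ones t"
      unfolding runs_of_ones_def mem_Collect_eq prod.case
    proof (intro conjI allI impI)
      show "i' \<le> j'" "j' \<le> length t" using r(1,2) by (auto simp: i j)
      show "t ! q" if "i' \<le> q \<and> q < j'" for q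
        using r(3)[of "q + Suc l"] that rest[of q] by (simp add: i j)
      show "i' = 0 \<or> \<not> t ! (i' - 1)"
        using r(4) rest[of "i' - 1"] by (cases i') (auto simp: i)
      show "j' = length t \<or> \<not> t ! j'"
        using r(5) rest[of j'] by (auto simp: j)
    qed
    then have "?f (i', j') \<in> ?f ` runs_of_ones t" by (rule imageI)
    then show ?thesis by (simp add: ij i j)
  qed
next
  have ones: "?s ! p" if "p < l" for p using that by (simp add: nth_append)
  have zero: "\<not> ?s ! l" by (simp add: nth_append)
  have rest: "?s ! (p + Suc l) = t ! p" for p by (simp add: nth_append)
  fix p assume "p \<in> insert (0, l) (?f ` runs_of_ones t)"
  then consider "p = (0, l)"
    | i j where "p = (i + Suc l, j + Suc l)" "(i, j) \<in> runs_of_ones t" by auto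
  then show "p \<in> runs_of_ones ?s"
  proof cases
    case 1
    then show ?thesis using ones zero by (auto simp: runs_of_ones_def)
  next
    case 2
    then have r: "i \<le> j" "j \<le> length t" "\<And>q. i \<le> q \<Longrightarrow> q < j \<Longrightarrow> t ! q"
      "i = 0 \<or> \<not> t ! (i - 1)" "j = length t \<or> \<not> t ! j"
      by (auto simp: runs_of_ones_def)
    show ?thesis
      unfolding runs_of_ones_def mem_Collect_eq prod.case 2(1)
    proof (intro conjI allI impI)
      show "i + Suc l \<le> j + Suc l" "j + Suc l \<le> length ?s" using r(1,2) by auto
      show "?s ! q" if "i + Suc l \<le> q \<and> q < j + Suc l" for q
        using r(3)[of "q - Suc l"] rest[of "q - Suc l"] that by fastforce
      show "i + Suc l = 0 \<or> \<not> ?s ! (i + Suc l - 1)"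
        using r(4) zero rest[of "i - 1"] by (cases i) auto
      show "j + Suc l = length ?s \<or> \<not> ?s ! (j + Suc l)"
        using r(5) rest[of j] by auto
    qed
  qed
qed

lemma finite_runs_of_ones: "finite (runs_of_ones s)"
  by (rule finite_subset[of _ "{..length s} \<times> {..length s}"]) (auto simp: runs_of_ones_def)

lemma num_runs_between_replicate:
  "num_runs_between a b (replicate n True) = of_bool (a \<le> n \<and> n \<le> b)"
proof -
  have "{(i, j) \<in> runs_of_ones (replicate n True). a \<le> j - i \<and> j - i \<le> b}
      = (if a \<le> n \<and> n \<le> b then {(0, n)} else {})"
    by (auto simp: runs_of_ones_replicate)
  then show ?thesis by (simp add: num_runs_between_def)
qed

lemma num_runs_between_first_run:
  "num_runs_between a b (replicate l True @ False # t) =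
     of_bool (a \<le> l \<and> l \<le> b) + num_runs_between a b t"
proof -
  define f where "f = (\<lambda>(i, j). (i + Suc l, j + Suc l))"
  define R where "R = {(i, j) \<in> runs_of_ones t. a \<le> j - i \<and> j - i \<le> b}"
  have "{(i, j) \<in> runs_of_ones (replicate l True @ False # t). a \<le> j - i \<and> j - i \<le> b}
      = (if a \<le> l \<and> l \<le> b then {(0, l)} else {}) \<union> f ` R"
    unfolding runs_of_ones_first_run f_def R_def by (auto simp: image_iff; force)
  moreover have "finite R"
    unfolding R_def by (rule finite_subset[OF _ finite_runs_of_ones[of t]]) auto
  moreover have "inj_on f R" by (auto simp: inj_on_def f_def)
  moreover have "(0, l) \<notin> f ` R" by (auto simp: f_def)
  ultimately show ?thesis
    by (auto simp: num_runs_between_def R_def[symmetric] card_image)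
qed

lemma strings_first_run:
  "strings n = insert (replicate n True)
     (\<Union>l<n. (\<lambda>t. replicate l True @ False # t) ` strings (n - 1 - l))"
proof (intro set_eqI iffI)
  fix s assume "s \<in> strings n"
  then have n: "n = length s" by (simp add: strings_def)
  show "s \<in> insert (replicate n True)
     (\<Union>l<n. (\<lambda>t. replicate l True @ False # t) ` strings (n - 1 - l))"
  proof (cases "False \<in> set s")
    case True
    then obtain u t where s: "s = u @ False # t" "False \<notin> set u"
      by (meson split_list_first)
    have "u = replicate (length u) True"
      using s(2) by (metis (full_types) replicate_eqI)
    then have "s = replicate (length u) True @ False # t" using s(1) by simp
    moreover have "t \<in> strings (n - 1 - length u)" "length u < n"
      by (simp_all add: strings_def n s(1))
    ultimately show ?thesis by blast
  next
    case False
    then have "s = replicate n True" unfolding n by (metis (full_types) replicate_eqI)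
    then show ?thesis by simp
  qed
qed (auto simp: strings_def)

lemma first_run_unique:
  assumes "replicate l True @ False # t = replicate l' True @ False # t'"
  shows "l = l' \<and> t = t'"
proof -
  have "takeWhile id (replicate l True @ False # t) = replicate l True" for l t
    by (induction l) auto
  then have "l = l'" using assms by (metis length_replicate)
  with assms show ?thesis by simp
qed

lemma finite_strings: "finite (strings n)"
  using finite_lists_length_eq[of "UNIV :: bool set" n] by (simp add: strings_def)

section \<open>The recursion for the counts\<close>

lemma w_at_least_0: "w_at_least 0 a b n = 2 ^ n"
  using card_lists_length_eq[of "UNIV :: bool set" n]
  by (simp add: w_at_least_def strings_def)

text \<open>
  The strings are classified by their first run: the indicator accounts for the string of \<open>n\<close>
  ones, which has a single run, and \<open>l < n\<close> is the length of a first run followed by a zero.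
  If that run is good, the remaining string needs one good run less.
\<close>

lemma w_at_least_Suc:
  "w_at_least (Suc m) a b n = of_bool (m = 0 \<and> a \<le> n \<and> n \<le> b) +
     (\<Sum>l<n. w_at_least (if a \<le> l \<and> l \<le> b then m else Suc m) a b (n - 1 - l))"
proof -
  define g where "g = (\<lambda>l t. replicate l True @ False # t)"
  define m' where "m' = (\<lambda>l. if a \<le> l \<and> l \<le> b then m else Suc m)"
  define T where "T = (\<lambda>l. {t \<in> strings (n - 1 - l). num_runs_between a b t \<ge> m' l})"
  define A where "A = (if m = 0 \<and> a \<le> n \<and> n \<le> b then {replicate n True} else {})"
  have fin: "finite (T l)" for l
    unfolding T_def using finite_strings by simp
  have inj: "inj_on (g l) (T l)" for l
    by (auto simp: inj_on_def g_def)
  have good: "Suc m \<le> num_runs_between a b (g l t) \<longleftrightarrow> m' l \<le> num_runs_between a b t" for l t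
    by (auto simp: g_def m'_def num_runs_between_first_run)
  have A: "A = {s \<in> {replicate n True}. num_runs_between a b s \<ge> Suc m}"
    by (auto simp: A_def num_runs_between_replicate)
  have split: "strings n = insert (replicate n True) (\<Union>l<n. g l ` strings (n - 1 - l))"
    unfolding g_def by (rule strings_first_run)
  have "{s \<in> strings n. num_runs_between a b s \<ge> Suc m} = A \<union> (\<Union>l<n. g l ` T l)"
    unfolding split A T_def good[symmetric] by auto
  then have "w_at_least (Suc m) a b n = card (A \<union> (\<Union>l<n. g l ` T l))"
    by (simp add: w_at_least_def)
  also have "\<dots> = card A + card (\<Union>l<n. g l ` T l)"
  proof (rule card_Un_disjoint)
    have "False \<notin> set s" if "s \<in> A" for s
      using that by (auto simp: A_def split: if_splits)
    moreover have "False \<in> set s" if "s \<in> (\<Union>l<n. g l ` T l)" for s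
      using that by (auto simp: g_def)
    ultimately show "A \<inter> (\<Union>l<n. g l ` T l) = {}" by blast
  qed (auto simp: A_def fin)
  also have "card (\<Union>l<n. g l ` T l) = (\<Sum>l<n. card (g l ` T l))"
    by (rule card_UN_disjoint) (auto simp: fin g_def dest: first_run_unique)
  also have "\<dots> = (\<Sum>l<n. w_at_least (m' l) a b (n - 1 - l))"
    by (simp add: card_image[OF inj]) (simp add: T_def w_at_least_def)
  also have "card A = of_bool (m = 0 \<and> a \<le> n \<and> n \<le> b)"
    by (simp add: A_def)
  finally show ?thesis by (simp add: m'_def)
qed

section \<open>Generating functions\<close>

definition w_gf :: "nat \<Rightarrow> nat \<Rightarrow> nat \<Rightarrow> rat fps" where
  "w_gf m a b = Abs_fps (\<lambda>n. of_nat (w_at_least m a b n))"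

definition interval_gf :: "nat \<Rightarrow> nat \<Rightarrow> rat fps" where
  "interval_gf a b = Abs_fps (\<lambda>l. of_bool (a \<le> l \<and> l \<le> b))"

lemma w_gf_0: "(1 - 2 * fps_X) * w_gf 0 a b = 1"
proof (rule fps_ext)
  fix n
  have "(1 - 2 * fps_X) * w_gf 0 a b = w_gf 0 a b - fps_const 2 * (fps_X * w_gf 0 a b)"
    by (simp add: algebra_simps numeral_fps_const)
  then show "((1 - 2 * fps_X) * w_gf 0 a b) $ n = 1 $ n"
    by (cases n) (simp_all add: w_gf_def w_at_least_0)
qed

lemma one_minus_X_interval_gf:
  assumes "a \<le> b"
  shows "(1 - fps_X) * interval_gf a b = fps_X ^ a - fps_X ^ Suc b"
proof (rule fps_ext)
  fix n
  show "((1 - fps_X) * interval_gf a b) $ n = (fps_X ^ a - fps_X ^ Suc b :: rat fps) $ n"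
    using assms
    by (cases n) (auto simp: left_diff_distrib interval_gf_def fps_X_power_nth
        simp del: power_Suc)
qed

text \<open>
  The recursion \<open>w_at_least_Suc\<close> in terms of series: its sum over \<open>l\<close> is a convolution, split
  according to whether the first run is good (\<open>interval_gf\<close>) or bad (its complement in \<open>ones\<close>),
  and the factor \<open>fps_X\<close> is the zero that follows the first run.
\<close>

lemma w_gf_Suc:
  defines "ones \<equiv> Abs_fps (\<lambda>_. 1) :: rat fps"
  shows "w_gf (Suc m) a b = of_bool (m = 0) * interval_gf a b +
    fps_X * (interval_gf a b * w_gf m a b + (ones - interval_gf a b) * w_gf (Suc m) a b)"
proof (rule fps_ext)
  fix n
  let ?I = "interval_gf a b"
  have *: "(?I * w_gf m a b + (ones - ?I) * w_gf (Suc m) a b) $ k =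
     (\<Sum>l\<le>k. of_nat (w_at_least (if a \<le> l \<and> l \<le> b then m else Suc m) a b (k - l)))" for k
    unfolding fps_add_nth fps_mult_nth atLeast0AtMost sum.distrib[symmetric]
    by (intro sum.cong) (auto simp: interval_gf_def w_gf_def ones_def)
  show "w_gf (Suc m) a b $ n = (of_bool (m = 0) * ?I +
    fps_X * (?I * w_gf m a b + (ones - ?I) * w_gf (Suc m) a b)) $ n"
  proof (cases n)
    case 0
    then show ?thesis by (simp add: w_gf_def w_at_least_Suc interval_gf_def)
  next
    case (Suc k)
    have "w_gf (Suc m) a b $ Suc k = of_bool (m = 0 \<and> a \<le> Suc k \<and> Suc k \<le> b) +
       (\<Sum>l\<le>k. of_nat (w_at_least (if a \<le> l \<and> l \<le> b then m else Suc m) a b (k - l)))"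
      by (simp add: w_gf_def w_at_least_Suc[of m a b "Suc k"] lessThan_Suc_atMost
           del: sum.lessThan_Suc)
    moreover have "(of_bool (m = 0) * ?I) $ Suc k = of_bool (m = 0 \<and> a \<le> Suc k \<and> Suc k \<le> b)"
      by (simp add: interval_gf_def)
    ultimately show ?thesis
      unfolding Suc fps_add_nth[of "of_bool (m = 0) * ?I"] fps_X_mult_nth
      using *[of k] by simp
  qed
qed

text \<open>
  The factor \<open>1 - x\<close> clears denominators in \<open>w_gf_Suc\<close>: it turns the geometric series of all
  runs into \<open>1\<close>, and \<open>x\<close> times the series of good runs into \<open>g\<close>. Collecting the terms in \<open>w_gf (Suc m)\<close> on the
  left leaves the factor \<open>(1 - x) - (x - g)\<close>.
\<close>

lemma w_gf_step:
  assumes "a \<le> b"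
  defines "g \<equiv> fps_X ^ (a + 1) - fps_X ^ (b + 2) :: rat fps"
  shows "(1 - 2 * fps_X + g) * (fps_X * w_gf (Suc m) a b) =
    g * (of_bool (m = 0) + fps_X * w_gf m a b)"
proof -
  define J where "J = (Abs_fps (\<lambda>_. 1) :: rat fps)"
  define I where "I = interval_gf a b"
  have J: "(1 - fps_X) * J = 1"
  proof (rule fps_ext)
    fix n show "((1 - fps_X) * J) $ n = 1 $ n"
      by (cases n) (simp_all add: left_diff_distrib J_def)
  qed
  have g: "g = fps_X * ((1 - fps_X) * I)"
    unfolding I_def one_minus_X_interval_gf[OF assms(1)] by (simp add: g_def algebra_simps)
  define W V where "W = w_gf (Suc m) a b" and "V = w_gf m a b"
  have W: "W = of_bool (m = 0) * I + fps_X * (I * V + (J - I) * W)"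
    unfolding W_def V_def I_def J_def by (rule w_gf_Suc)
  have "(1 - fps_X) * (fps_X * W) = g * of_bool (m = 0) +
      fps_X * (g * V + fps_X * ((1 - fps_X) * J) * W - g * W)"
    by (subst W) (simp add: g algebra_simps)
  then show ?thesis
    unfolding J W_def[symmetric] V_def[symmetric] by (simp add: algebra_simps)
qed

text \<open>
  Each use of \<open>w_gf_step\<close> trades a factor \<open>1 - 2x + g\<close> for a factor \<open>g\<close>. The last one leaves
  \<open>1 + x W 0\<close> with \<open>W 0 = 1 / (1 - 2x)\<close>, hence the factor \<open>1 - x = (1 - 2x) + x\<close>.
\<close>

lemma w_gf_closed:
  assumes "a \<le> b"
  defines "g \<equiv> fps_X ^ (a + 1) - fps_X ^ (b + 2) :: rat fps"
  shows "(1 - 2 * fps_X) * fps_X * (1 - 2 * fps_X + g) ^ Suc m * w_gf (Suc m) a b =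
    (1 - fps_X) * g ^ Suc m"
proof (induction m)
  note step = w_gf_step[OF assms(1), folded g_def]
  define d where "d = 1 - 2 * fps_X + g"
  note step = step[folded d_def]
  {
    case 0
    have "(1 - 2 * fps_X) * fps_X * d ^ Suc 0 * w_gf (Suc 0) a b =
        (1 - 2 * fps_X) * (d * (fps_X * w_gf (Suc 0) a b))"
      by (simp add: mult_ac)
    also have "\<dots> = g * ((1 - 2 * fps_X) + fps_X * ((1 - 2 * fps_X) * w_gf 0 a b))"
      unfolding step by (simp add: algebra_simps)
    also have "\<dots> = (1 - fps_X) * g ^ Suc 0"
      unfolding w_gf_0 by (simp add: algebra_simps)
    finally show ?case by (simp add: d_def)
  next
    case (Suc m)
    have "(1 - 2 * fps_X) * fps_X * d ^ Suc (Suc m) * w_gf (Suc (Suc m)) a b =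
        (1 - 2 * fps_X) * d ^ Suc m * (d * (fps_X * w_gf (Suc (Suc m)) a b))"
      by (simp add: mult_ac)
    also have "\<dots> = g * ((1 - 2 * fps_X) * fps_X * d ^ Suc m * w_gf (Suc m) a b)"
      unfolding step by (simp add: mult_ac)
    also have "\<dots> = (1 - fps_X) * g ^ Suc (Suc m)"
      unfolding Suc.IH[folded d_def] by (simp add: mult_ac)
    finally show ?case by (simp add: d_def)
  }
qed

theorem mainTheorem5:
  fixes klo khi m :: nat
  assumes "klo \<le> khi" and "m \<ge> 1"
  shows "fps_to_fls (Abs_fps (\<lambda>n. of_nat (w_at_least m klo khi n) :: rat)) =
    (1 - fls_X) / ((1 - 2 * fls_X) * fls_X) *
    ((fls_X ^ (klo + 1) - fls_X ^ (khi + 2)) /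
     (1 - 2 * fls_X + fls_X ^ (klo + 1) - fls_X ^ (khi + 2))) ^ m"
proof -
  define c g d :: "rat fps" where "c = 1 - 2 * fps_X"
    and "g = fps_X ^ (klo + 1) - fps_X ^ (khi + 2)" and "d = c + g"
  obtain k where m: "m = Suc k" using assms(2) by (cases m) auto
  have "c * fps_X * d ^ m * w_gf m klo khi = (1 - fps_X) * g ^ m"
    unfolding m c_def d_def g_def by (rule w_gf_closed[OF assms(1)])
  then have "fps_to_fls (c * fps_X * d ^ m * w_gf m klo khi) = fps_to_fls ((1 - fps_X) * g ^ m)"
    by simp
  then have main: "fps_to_fls c * fls_X * fps_to_fls d ^ m * fps_to_fls (w_gf m klo khi)
      = (1 - fls_X) * fps_to_fls g ^ m"
    by (simp add: fls_times_fps_to_fls fps_to_fls_power)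
  \<comment> \<open>Both exponents in \<open>g\<close> are positive, so the denominators have constant term \<open>1\<close>.\<close>
  have "c $ 0 = 1" "d $ 0 = 1"
    by (simp_all add: c_def d_def g_def)
  then have nz: "fps_to_fls c \<noteq> 0" "fps_to_fls d \<noteq> 0" by auto
  have c: "fps_to_fls c = 1 - 2 * fls_X"
    by (simp add: c_def fls_times_fps_to_fls)
  have g: "fps_to_fls g = fls_X ^ (klo + 1) - fls_X ^ (khi + 2)"
    by (simp add: g_def fls_times_fps_to_fls fps_to_fls_power)
  have d: "fps_to_fls d = 1 - 2 * fls_X + fls_X ^ (klo + 1) - fls_X ^ (khi + 2)"
    by (simp add: d_def c g)
  have "fps_to_fls (w_gf m klo khi) =
      (1 - fls_X) / (fps_to_fls c * fls_X) * (fps_to_fls g / fps_to_fls d) ^ m"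
    using main nz by (simp add: power_divide field_simps)
  then show ?thesis unfolding c g d w_gf_def .
qed

end
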